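(* Let $n\geq 2$ and $k\geq 1$ be integers. Then the VC-dimension of the set system on ground set $\mathbb{A}_{n,n-2}$ whose sets are, for each choice of $V_1,\dots,V_k\in\mathbb{A}_{n,n-1}$, the set $\{W\in\mathbb{A}_{n,n-2}: W\subseteq V_i \text{ for some } i\le k\}$, equals $\mathsf{VC}\text{-}\mathsf{dim}(\mathcal{F}_k)$, where $\mathcal{F}_k$ is the family of unions of $k$ lines in $\mathbb{R}^2$.
   Context: $\mathbb{A}_{n,m}$ denotes the set of $m$-dimensional affine subspaces of $\mathbb{R}^n$. Each $V\in\mathbb{A}_{n,n-1}$ is identified with the set $\{W\in\mathbb{A}_{n,n-2}: W\subseteq V\}$, and the $k$-fold union family $\mathbb{A}_{n,n-1}^{\cup k}$ consists of unions of $k$ such sets. $\mathcal{F}_k=\{l_1\cup\dots\cup l_k: l_i \text{ lines in } \mathbb{R}^2\}$. A family $\mathcal{S}$ of subsets of $X$ shatters $Y\subseteq X$ if for every $Z\subseteq Y$ there is $S\in\mathcal{S}$ with $S\cap Y=Z$; the VC-dimension is the largest size of a shattered set. *)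

theory Defs
  imports "HOL-Analysis.Analysis" "HOL-Library.Extended_Nat"
begin

text \<open>The empty set is affine but has affine dimension \<open>-1\<close>, so it is never a member.\<close>
definition affine_subspaces :: "nat \<Rightarrow> 'a::euclidean_space set set" where
  "affine_subspaces m = {V. affine V \<and> aff_dim V = int m}"

definition shatters :: "'a set set \<Rightarrow> 'a set \<Rightarrow> bool" where
  "shatters \<S> Y \<longleftrightarrow> (\<forall>Z\<subseteq>Y. \<exists>S\<in>\<S>. S \<inter> Y = Z)"

text \<open>The value is \<open>\<infinity>\<close> if there are arbitrarily large finite shattered sets. Subsets of shattered
  sets are shattered, so this covers infinite shattered sets as well.\<close>
definition VC_dim :: "'a set \<Rightarrow> 'a set set \<Rightarrow> enat" where
  "VC_dim X \<S> = Sup {enat (card Y) | Y. Y \<subseteq> X \<and> finite Y \<and> shatters \<S> Y}"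

definition hyperplane_unions :: "nat \<Rightarrow> (real ^ 'n) set set set" where
  "hyperplane_unions k =
     {{W \<in> affine_subspaces (CARD('n) - 2). \<exists>i\<in>{1..k}. W \<subseteq> V i} | V.
        \<forall>i\<in>{1..k}. V i \<in> affine_subspaces (CARD('n) - 1)}"

definition line_unions :: "nat \<Rightarrow> (real ^ 2) set set" where
  "line_unions k = {(\<Union>i\<in>{1..k}. l i) | l. \<forall>i\<in>{1..k}. l i \<in> affine_subspaces 1}"

end

theory Submission
  imports Defs
begin

text \<open>Pulling back along a linear surjection onto the plane turns points and lines into subspaces of
  codimension 2 and 1 with the same incidences. Conversely, a finite shattered set is shattered by
  finitely many unions of hyperplanes, and a generic plane section of this finite configuration turns
  subspaces of codimension 2 and 1 into points and lines, again with the same incidences.\<close>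

section \<open>Transfer of shattered sets\<close>

text \<open>Every subset of \<open>Y\<close> is the trace of some member of \<open>\<T>\<close>, and
  the matching member of \<open>\<S>\<close> cuts out its image. Traces on singletons already
  separate points, so injectivity of \<open>f\<close> is a conclusion and need not be checked for
  each map.\<close>

lemma shatters_image:
  assumes sh: "shatters \<T> Y"
    and tr: "\<And>S. S \<in> \<T> \<Longrightarrow> \<exists>S'\<in>\<S>. \<forall>y\<in>Y. f y \<in> S' \<longleftrightarrow> y \<in> S"
  shows "inj_on f Y" and "shatters \<S> (f ` Y)"
proof -
  have ex: "\<exists>S'\<in>\<S>. \<forall>y\<in>Y. f y \<in> S' \<longleftrightarrow> y \<in> Z" if Z: "Z \<subseteq> Y" for Z
  proof -
    obtain S where S: "S \<in> \<T>" "S \<inter> Y = Z"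
      using sh Z unfolding shatters_def by blast
    then show ?thesis using tr[OF S(1)] by blast
  qed
  show "inj_on f Y"
  proof (rule inj_onI)
    fix x y assume xy: "x \<in> Y" "y \<in> Y" "f x = f y"
    then obtain S' where "\<forall>z\<in>Y. f z \<in> S' \<longleftrightarrow> z \<in> {x}" using ex[of "{x}"] by blast
    then show "x = y" using xy by (metis singletonD singletonI)
  qed
  show "shatters \<S> (f ` Y)"
    unfolding shatters_def
  proof (intro allI impI)
    fix Z assume Z: "Z \<subseteq> f ` Y"
    obtain S' where "S' \<in> \<S>" "\<forall>y\<in>Y. f y \<in> S' \<longleftrightarrow> y \<in> {y \<in> Y. f y \<in> Z}"
      using ex[of "{y \<in> Y. f y \<in> Z}"] by blast
    then show "\<exists>S\<in>\<S>. S \<inter> f ` Y = Z" using Z by (intro bexI[of _ S']) auto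
  qed
qed

text \<open>One witness per subset of \<open>Y\<close> is enough. The reduction to finitely many
  sets is what later makes a generic choice possible.\<close>

lemma shatters_finite_subsystem:
  assumes "shatters \<S> Y" "finite Y"
  obtains \<T> where "finite \<T>" "\<T> \<subseteq> \<S>" "shatters \<T> Y"
proof -
  obtain S where S: "\<And>Z. Z \<subseteq> Y \<Longrightarrow> S Z \<in> \<S> \<and> S Z \<inter> Y = Z"
    using assms(1) unfolding shatters_def by metis
  show ?thesis
  proof
    show "finite (S ` Pow Y)" using assms(2) by simp
    show "S ` Pow Y \<subseteq> \<S>" using S by auto
    show "shatters (S ` Pow Y) Y" using S by (auto simp: shatters_def)
  qed
qed

text \<open>The map \<open>f\<close> may depend on both \<open>Y\<close> and the finite subsystem
  \<open>\<T>\<close>, so a plane section adapted to one finite configuration can serve as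
  \<open>f\<close>.\<close>

lemma VC_dim_le_transfer:
  assumes "\<And>Y \<T>. \<lbrakk>Y \<subseteq> X; finite Y; finite \<T>; \<T> \<subseteq> \<S>\<rbrakk> \<Longrightarrow>
    \<exists>f. f ` Y \<subseteq> X' \<and> (\<forall>S\<in>\<T>. \<exists>S'\<in>\<S>'. \<forall>y\<in>Y. f y \<in> S' \<longleftrightarrow> y \<in> S)"
  shows "VC_dim X \<S> \<le> VC_dim X' \<S>'"
  unfolding VC_dim_def
proof (rule Sup_mono)
  fix d assume "d \<in> {enat (card Y) |Y. Y \<subseteq> X \<and> finite Y \<and> shatters \<S> Y}"
  then obtain Y where Y: "d = enat (card Y)" "Y \<subseteq> X" "finite Y" "shatters \<S> Y" by blast
  obtain \<T> where \<T>: "finite \<T>" "\<T> \<subseteq> \<S>" "shatters \<T> Y"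
    using shatters_finite_subsystem Y by metis
  obtain f where f: "f ` Y \<subseteq> X'" "\<forall>S\<in>\<T>. \<exists>S'\<in>\<S>'. \<forall>y\<in>Y. f y \<in> S' \<longleftrightarrow> y \<in> S"
    using assms Y \<T> by metis
  have "inj_on f Y" "shatters \<S>' (f ` Y)"
    using shatters_image[OF \<T>(3)] f(2) by blast+
  then show "\<exists>d'\<in>{enat (card Y) |Y. Y \<subseteq> X' \<and> finite Y \<and> shatters \<S>' Y}. d \<le> d'"
    using Y f(1)
    by (intro bexI[of _ "enat (card (f ` Y))"] CollectI exI[of _ "f ` Y"]) (auto simp: card_image)
qed

section \<open>Linear equations for subspaces of codimension 1 and 2\<close>

lemma affine_subspaces_hyperplane:
  fixes V :: "'a::euclidean_space set"
  shows "V \<in> affine_subspaces (DIM('a) - 1) \<longleftrightarrow> (\<exists>v c. v \<noteq> 0 \<and> V = {x. v \<bullet> x = c})"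
proof -
  have "int (DIM('a) - 1) = int DIM('a) - 1"
    using DIM_positive[where 'a='a] by linarith
  then have "V \<in> affine_subspaces (DIM('a) - 1) \<longleftrightarrow> affine V \<and> aff_dim V = int DIM('a) - 1"
    by (simp add: affine_subspaces_def)
  also have "\<dots> \<longleftrightarrow> affine V \<and> (\<exists>v c. v \<noteq> 0 \<and> affine hull V = {x. v \<bullet> x = c})"
    using aff_dim_eq_hyperplane[of V] by simp
  also have "\<dots> \<longleftrightarrow> (\<exists>v c. v \<noteq> 0 \<and> V = {x. v \<bullet> x = c})"
  proof (cases "affine V")
    case True
    then show ?thesis by (simp add: affine_hull_eq[THEN iffD2])
  qed (auto simp: affine_hyperplane)
  finally show ?thesis .
qed

text \<open>\<open>W\<close> is the intersection of two distinct hyperplanes. Dependent normals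
  would make them parallel, and parallel hyperplanes with a common point coincide.\<close>

lemma affine_subspaces_codim_2:
  fixes W :: "'a::euclidean_space set"
  assumes dim: "DIM('a) \<ge> 2" and W: "W \<in> affine_subspaces (DIM('a) - 2)"
  obtains A B \<alpha> \<beta> where "W = {x. A \<bullet> x = \<alpha> \<and> B \<bullet> x = \<beta>}"
    and "\<And>s t. s *\<^sub>R A + t *\<^sub>R B = 0 \<Longrightarrow> s = 0 \<and> t = 0"
proof -
  have aff: "affine W" and ad: "aff_dim W = int DIM('a) - 2"
    using W dim by (auto simp: affine_subspaces_def of_nat_diff)
  \<comment> \<open>Here \<open>dim\<close> matters: it makes the dimension of \<open>W\<close> at
    least 0, whereas the empty set has dimension -1.\<close>
  have ne: "W \<noteq> {}" using ad dim by auto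
  obtain \<F> where F: "finite \<F>" "of_nat (card \<F>) + aff_dim W = int DIM('a)" "affine hull W = \<Inter>\<F>"
      "\<And>h. h \<in> \<F> \<Longrightarrow> \<exists>a b. a \<noteq> 0 \<and> h = {x. a \<bullet> x = b}"
    using affine_hull_finite_intersection_hyperplanes by metis
  have "card \<F> = 2" using F(2) ad by linarith
  then obtain h1 h2 where h: "\<F> = {h1, h2}" "h1 \<noteq> h2" by (auto simp: card_2_iff)
  obtain A \<alpha> where A: "A \<noteq> 0" "h1 = {x. A \<bullet> x = \<alpha>}" using F(4) h by blast
  obtain B \<beta> where B: "B \<noteq> 0" "h2 = {x. B \<bullet> x = \<beta>}" using F(4) h by blast
  have Weq: "W = {x. A \<bullet> x = \<alpha> \<and> B \<bullet> x = \<beta>}"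
    using F(3) h A(2) B(2) aff by (auto simp: affine_hull_eq[THEN iffD2])
  obtain x0 where x0: "A \<bullet> x0 = \<alpha>" "B \<bullet> x0 = \<beta>" using ne Weq by auto
  show ?thesis
  proof (rule that[OF Weq], rule ccontr)
    fix s t assume st: "s *\<^sub>R A + t *\<^sub>R B = 0" and "\<not> (s = 0 \<and> t = 0)"
    then have nz: "s \<noteq> 0" "t \<noteq> 0" using A(1) B(1) by auto
    have "s * (A \<bullet> (x - x0)) + t * (B \<bullet> (x - x0)) = 0" for x
      using arg_cong[OF st, of "\<lambda>y. y \<bullet> (x - x0)"] by (simp add: inner_add_left)
    then have "A \<bullet> (x - x0) = 0 \<longleftrightarrow> B \<bullet> (x - x0) = 0" for x
      using nz by (metis add.left_neutral add.right_neutral mult_eq_0_iff)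
    then have "h1 = h2" using A(2) B(2) x0 by (auto simp: inner_diff_right)
    then show False using h by simp
  qed
qed

section \<open>Generic choices and plane sections\<close>

lemma finite_hyperplanes_not_cover:
  fixes v :: "'i \<Rightarrow> 'a::euclidean_space"
  assumes "finite I" and "\<And>i. i \<in> I \<Longrightarrow> v i \<noteq> 0 \<or> c i \<noteq> 0"
  shows "\<exists>x. \<forall>i\<in>I. v i \<bullet> x \<noteq> c i"
proof -
  have "negligible (\<Union>i\<in>I. {x. v i \<bullet> x = c i})"
    using assms by (intro negligible_Union) (auto intro: negligible_hyperplane)
  then have "(\<Union>i\<in>I. {x. v i \<bullet> x = c i}) \<noteq> UNIV"
    using non_negligible_UNIV by metis
  then show ?thesis by auto
qed

lemma inner_real_2: "x \<bullet> y = x $ 1 * y $ 1 + x $ 2 * y $ 2" for x y :: "real ^ 2"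
  by (simp add: inner_vec_def sum_2)

text \<open>The plane is \<open>a + span {b, c}\<close>. Given \<open>b\<close> and \<open>c\<close> transversal to all the \<open>W\<close>, the intersection
  point with \<open>W\<close> is the projection of \<open>a\<close> to \<open>W\<close> along \<open>span {b, c}\<close>; it is affine in \<open>a\<close>, and onto \<open>W\<close>,
  so for \<open>W\<close> not contained in \<open>V\<close> it lies in \<open>V\<close> only for \<open>a\<close> in a proper affine subspace.\<close>
lemma generic_plane_section:
  fixes \<W> \<V> :: "'a::euclidean_space set set"
  assumes dim: "DIM('a) \<ge> 2" and fin: "finite \<W>" "finite \<V>"
    and W: "\<W> \<subseteq> affine_subspaces (DIM('a) - 2)"
    and V: "\<V> \<subseteq> affine_subspaces (DIM('a) - 1)"
  shows "\<exists>(p :: 'a set \<Rightarrow> real ^ 2) l. (\<forall>V\<in>\<V>. l V \<in> affine_subspaces 1) \<and>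
    (\<forall>W\<in>\<W>. \<forall>V\<in>\<V>. p W \<in> l V \<longleftrightarrow> W \<subseteq> V)"
proof -
  have "\<forall>V\<in>\<V>. \<exists>v c. v \<noteq> 0 \<and> V = {x. v \<bullet> x = c}"
    using V affine_subspaces_hyperplane by blast
  then obtain v \<gamma> where v: "\<And>V. V \<in> \<V> \<Longrightarrow> v V \<noteq> 0" "\<And>V. V \<in> \<V> \<Longrightarrow> V = {x. v V \<bullet> x = \<gamma> V}"
    by metis
  have "\<forall>W\<in>\<W>. \<exists>A \<alpha> B \<beta>. W = {x. A \<bullet> x = \<alpha> \<and> B \<bullet> x = \<beta>} \<and>
      (\<forall>s t. s *\<^sub>R A + t *\<^sub>R B = 0 \<longrightarrow> s = 0 \<and> t = 0)"
  proof
    fix W assume "W \<in> \<W>"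
    then have "W \<in> affine_subspaces (DIM('a) - 2)" using W by blast
    then show "\<exists>A \<alpha> B \<beta>. W = {x. A \<bullet> x = \<alpha> \<and> B \<bullet> x = \<beta>} \<and>
        (\<forall>s t. s *\<^sub>R A + t *\<^sub>R B = 0 \<longrightarrow> s = 0 \<and> t = 0)"
      by (rule affine_subspaces_codim_2[OF dim]) blast
  qed
  then obtain A \<alpha> B \<beta> where AB: "\<forall>W\<in>\<W>. W = {x. A W \<bullet> x = \<alpha> W \<and> B W \<bullet> x = \<beta> W} \<and>
      (\<forall>s t. s *\<^sub>R A W + t *\<^sub>R B W = 0 \<longrightarrow> s = 0 \<and> t = 0)"
    unfolding bchoice_iff by (elim exE) (rule that)
  note Weq = AB[rule_format, THEN conjunct1] and ind = AB[rule_format, THEN conjunct2, rule_format]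
  have "v V \<noteq> 0" if "V \<in> \<V>" for V using v that by blast
  moreover have "A W \<noteq> 0" if "W \<in> \<W>" for W using ind[OF that, of 1 0] by auto
  ultimately have "w \<noteq> 0 \<or> (0 :: real) \<noteq> 0" if "w \<in> v ` \<V> \<union> A ` \<W>" for w
    using that by auto
  \<comment> \<open>\<open>v V \<bullet> b \<noteq> 0\<close> will make the section of
    \<open>V\<close> a line; \<open>A W \<bullet> b \<noteq> 0\<close> makes the next vector a
    nontrivial combination of independent normals.\<close>
  then obtain b where b: "\<forall>w \<in> v ` \<V> \<union> A ` \<W>. w \<bullet> b \<noteq> 0"
    using finite_hyperplanes_not_cover[of "v ` \<V> \<union> A ` \<W>" "\<lambda>w. w" "\<lambda>_. 0"] fin by auto
  have "(A W \<bullet> b) *\<^sub>R B W - (B W \<bullet> b) *\<^sub>R A W \<noteq> 0" if "W \<in> \<W>" for W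
    using ind[OF that, of "- (B W \<bullet> b)" "A W \<bullet> b"] b that by auto
  then obtain c where c: "\<And>W. W \<in> \<W> \<Longrightarrow> ((A W \<bullet> b) *\<^sub>R B W - (B W \<bullet> b) *\<^sub>R A W) \<bullet> c \<noteq> 0"
    using finite_hyperplanes_not_cover[OF fin(1),
      of "\<lambda>W. (A W \<bullet> b) *\<^sub>R B W - (B W \<bullet> b) *\<^sub>R A W" "\<lambda>_. 0"] by auto
  \<comment> \<open>\<open>D W\<close> is the determinant of the two equations of \<open>W\<close>
    restricted to the directions \<open>b\<close> and \<open>c\<close>; it is nonzero exactly when
    they have a unique solution.\<close>
  define D where "D W = (A W \<bullet> b) * (B W \<bullet> c) - (B W \<bullet> b) * (A W \<bullet> c)" for W
  have D: "D W \<noteq> 0" if "W \<in> \<W>" for W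
    using c[OF that] by (simp add: D_def inner_diff_left)
  \<comment> \<open>Cramer's rule: the point of \<open>W\<close> is \<open>a + (s W a / D W) b + (t W a / D W) c\<close>.\<close>
  define s where "s W a = (\<alpha> W - A W \<bullet> a) * (B W \<bullet> c) - (\<beta> W - B W \<bullet> a) * (A W \<bullet> c)" for W a
  define t where "t W a = (\<beta> W - B W \<bullet> a) * (A W \<bullet> b) - (\<alpha> W - A W \<bullet> a) * (B W \<bullet> b)" for W a
  \<comment> \<open>Substituting the section point of \<open>W\<close> into the equation of
    \<open>V\<close> and multiplying by \<open>D W\<close> leaves an equation affine in
    \<open>a\<close>, namely \<open>q W V \<bullet> a = r W V\<close>.\<close>
  define q where "q W V = D W *\<^sub>R v V
      - ((v V \<bullet> b) * (B W \<bullet> c) - (v V \<bullet> c) * (B W \<bullet> b)) *\<^sub>R A W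
      - ((v V \<bullet> c) * (A W \<bullet> b) - (v V \<bullet> b) * (A W \<bullet> c)) *\<^sub>R B W" for W V
  define r where "r W V = D W * \<gamma> V
      - ((v V \<bullet> b) * (B W \<bullet> c) - (v V \<bullet> c) * (B W \<bullet> b)) * \<alpha> W
      - ((v V \<bullet> c) * (A W \<bullet> b) - (v V \<bullet> b) * (A W \<bullet> c)) * \<beta> W" for W V
  have qr: "q W V \<bullet> a - r W V
      = D W * (v V \<bullet> a - \<gamma> V) + s W a * (v V \<bullet> b) + t W a * (v V \<bullet> c)" for W V a
    unfolding q_def r_def s_def t_def inner_diff_left inner_scaleR_left by (simp add: algebra_simps)
  define I where "I = {(W, V). W \<in> \<W> \<and> V \<in> \<V> \<and> \<not> W \<subseteq> V}"
  have "I \<subseteq> \<W> \<times> \<V>" by (auto simp: I_def)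
  then have "finite I" using fin by (meson finite_SigmaI finite_subset)
  \<comment> \<open>If \<open>W\<close> is parallel to \<open>V\<close>, then \<open>q W V\<close>
    is zero, so \<open>r W V\<close> must be allowed as the nonzero entry. Both cases follow by
    taking as base point some \<open>x\<close> in \<open>W\<close> outside \<open>V\<close>: it is
    its own section point, so the equation fails there.\<close>
  moreover have "q W V \<noteq> 0 \<or> r W V \<noteq> 0" if WV: "(W, V) \<in> I" for W V
  proof -
    have I: "W \<in> \<W>" "V \<in> \<V>" using WV by (auto simp: I_def)
    obtain x where x: "x \<in> W" "x \<notin> V" using WV by (auto simp: I_def)
    have "A W \<bullet> x = \<alpha> W" "B W \<bullet> x = \<beta> W" using x(1) Weq[OF I(1)] by blast+
    then have "s W x = 0" "t W x = 0" by (simp_all add: s_def t_def)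
    moreover have "v V \<bullet> x \<noteq> \<gamma> V" using x(2) v(2)[OF I(2)] by blast
    ultimately have "q W V \<bullet> x - r W V \<noteq> 0" using D[OF I(1)] by (simp add: qr)
    then show ?thesis by auto
  qed
  ultimately obtain a where a: "\<And>W V. (W, V) \<in> I \<Longrightarrow> q W V \<bullet> a \<noteq> r W V"
    using finite_hyperplanes_not_cover[of I "\<lambda>(W, V). q W V" "\<lambda>(W, V). r W V"] by fastforce
  define P where "P u = a + (u $ 1) *\<^sub>R b + (u $ 2) *\<^sub>R c" for u :: "real ^ 2"
  define p :: "'a set \<Rightarrow> real ^ 2" where "p W = vector [s W a / D W, t W a / D W]" for W
  show ?thesis
  proof (intro exI[of _ p] exI[of _ "\<lambda>V. P -` V"] conjI ballI)
    fix V assume V: "V \<in> \<V>"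
    define w :: "real ^ 2" where "w = vector [v V \<bullet> b, v V \<bullet> c]"
    have "w $ 1 \<noteq> 0" using b V by (auto simp: w_def)
    then have "w \<noteq> 0" by auto
    moreover have "P u \<in> V \<longleftrightarrow> w \<bullet> u = \<gamma> V - v V \<bullet> a" for u
    proof -
      have "P u \<in> V \<longleftrightarrow> v V \<bullet> P u = \<gamma> V" using v(2)[OF V] by blast
      then show ?thesis by (auto simp: P_def w_def inner_real_2 inner_add_right algebra_simps)
    qed
    then have "P -` V = {u. w \<bullet> u = \<gamma> V - v V \<bullet> a}" by auto
    ultimately show "P -` V \<in> affine_subspaces 1"
      using affine_subspaces_hyperplane[of "P -` V"] by auto
  next
    fix W V assume WV: "W \<in> \<W>" "V \<in> \<V>"
    have Pp: "y \<bullet> P (p W) = y \<bullet> a + (s W a * (y \<bullet> b) + t W a * (y \<bullet> c)) / D W" for y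
      by (simp add: P_def p_def inner_add_right add_divide_distrib)
    have "s W a * (A W \<bullet> b) + t W a * (A W \<bullet> c) = D W * (\<alpha> W - A W \<bullet> a)"
      "s W a * (B W \<bullet> b) + t W a * (B W \<bullet> c) = D W * (\<beta> W - B W \<bullet> a)"
      by (simp_all add: s_def t_def D_def algebra_simps)
    then have "A W \<bullet> P (p W) = \<alpha> W" "B W \<bullet> P (p W) = \<beta> W"
      using D[OF WV(1)] by (simp_all add: Pp)
    \<comment> \<open>This already gives incidence when \<open>W \<subseteq> V\<close>; the generic
      choice of \<open>a\<close> serves only the converse.\<close>
    then have "P (p W) \<in> W" using Weq[OF WV(1)] by blast
    moreover have "P (p W) \<notin> V" if "\<not> W \<subseteq> V"
    proof -
      have "q W V \<bullet> a \<noteq> r W V" using a WV that by (auto simp: I_def)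
      then have "D W * (v V \<bullet> a - \<gamma> V) + s W a * (v V \<bullet> b) + t W a * (v V \<bullet> c) \<noteq> 0"
        using qr[of W V a] by simp
      then have "v V \<bullet> P (p W) \<noteq> \<gamma> V"
        using D[OF WV(1)] by (auto simp: Pp field_simps)
      then show ?thesis using v(2)[OF WV(2)] by blast
    qed
    ultimately show "p W \<in> P -` V \<longleftrightarrow> W \<subseteq> V" by auto
  qed
qed

section \<open>The two inequalities\<close>

lemma VC_dim_hyperplane_unions_le:
  assumes "CARD('n::finite) \<ge> 2"
  shows "VC_dim (affine_subspaces (CARD('n) - 2) :: (real ^ 'n) set set) (hyperplane_unions k)
       \<le> VC_dim UNIV (line_unions k)"
proof (rule VC_dim_le_transfer)
  fix Y :: "(real ^ 'n) set set" and \<T> :: "(real ^ 'n) set set set"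
  assume Y: "Y \<subseteq> affine_subspaces (CARD('n) - 2)" "finite Y"
    and \<T>: "finite \<T>" "\<T> \<subseteq> hyperplane_unions k"
  have "\<forall>S\<in>\<T>. \<exists>V. (\<forall>i\<in>{1..k}. V i \<in> affine_subspaces (CARD('n) - 1)) \<and>
      S = {W \<in> affine_subspaces (CARD('n) - 2). \<exists>i\<in>{1..k}. W \<subseteq> V i}"
    using \<T>(2) by (force simp: hyperplane_unions_def)
  then obtain V where VS: "\<forall>S\<in>\<T>. (\<forall>i\<in>{1..k}. V S i \<in> affine_subspaces (CARD('n) - 1)) \<and>
      S = {W \<in> affine_subspaces (CARD('n) - 2). \<exists>i\<in>{1..k}. W \<subseteq> V S i}"
    unfolding bchoice_iff by (elim exE) (rule that)
  note V = VS[rule_format, THEN conjunct1, rule_format] and S = VS[rule_format, THEN conjunct2]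
  \<comment> \<open>All hyperplanes occurring in any member of \<open>\<T>\<close> are collected, so
    that a single section works for every union at once.\<close>
  define \<V> where "\<V> = (\<Union>S\<in>\<T>. V S ` {1..k})"
  have "finite \<V>" "\<V> \<subseteq> affine_subspaces (CARD('n) - 1)"
    using \<T>(1) V by (auto simp: \<V>_def)
  then obtain p :: "(real ^ 'n) set \<Rightarrow> real ^ 2" and l
    where l: "\<forall>V\<in>\<V>. l V \<in> affine_subspaces 1"
      and pl: "\<forall>W\<in>Y. \<forall>V\<in>\<V>. p W \<in> l V \<longleftrightarrow> W \<subseteq> V"
    using generic_plane_section[of Y \<V>] Y assms by auto
  have "\<exists>S'\<in>line_unions k. \<forall>y\<in>Y. p y \<in> S' \<longleftrightarrow> y \<in> S" if "S \<in> \<T>" for S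
  proof (intro bexI ballI)
    have mem: "V S i \<in> \<V>" if "i \<in> {1..k}" for i
      unfolding \<V>_def using that \<open>S \<in> \<T>\<close> by blast
    show "(\<Union>i\<in>{1..k}. l (V S i)) \<in> line_unions k"
      unfolding line_unions_def using l mem by blast
    show "p y \<in> (\<Union>i\<in>{1..k}. l (V S i)) \<longleftrightarrow> y \<in> S" if y: "y \<in> Y" for y
    proof -
      have "y \<in> S \<longleftrightarrow> y \<in> {W \<in> affine_subspaces (CARD('n) - 2). \<exists>i\<in>{1..k}. W \<subseteq> V S i}"
        by (rule arg_cong[OF S[OF \<open>S \<in> \<T>\<close>]])
      also have "\<dots> \<longleftrightarrow> (\<exists>i\<in>{1..k}. y \<subseteq> V S i)" using y Y(1) by auto
      also have "\<dots> \<longleftrightarrow> (\<exists>i\<in>{1..k}. p y \<in> l (V S i))" using y pl mem by auto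
      finally show ?thesis by simp
    qed
  qed
  then show "\<exists>f. f ` Y \<subseteq> (UNIV :: (real ^ 2) set) \<and>
      (\<forall>S\<in>\<T>. \<exists>S'\<in>line_unions k. \<forall>y\<in>Y. f y \<in> S' \<longleftrightarrow> y \<in> S)" by blast
qed

text \<open>Preimages under a projection to two distinct coordinates turn points and lines into
  subspaces of codimension 2 and 1.\<close>

lemma VC_dim_line_unions_le:
  assumes "CARD('n::finite) \<ge> 2"
  shows "VC_dim UNIV (line_unions k)
       \<le> VC_dim (affine_subspaces (CARD('n) - 2) :: (real ^ 'n) set set) (hyperplane_unions k)"
proof (rule VC_dim_le_transfer)
  fix Y :: "(real ^ 2) set" and \<T> :: "(real ^ 2) set set"
  assume \<T>: "\<T> \<subseteq> line_unions k"
  obtain i j :: 'n where ij: "i \<noteq> j"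
    using assms by (metis card_2_iff' ex_card)
  define \<pi> :: "real ^ 'n \<Rightarrow> real ^ 2" where "\<pi> x = vector [x $ i, x $ j]" for x
  \<comment> \<open>The adjoint of \<open>\<pi>\<close> carries the normal of a line to the normal
    of its preimage.\<close>
  have inner_\<pi>: "w \<bullet> \<pi> x = (w $ 1 *\<^sub>R axis i 1 + w $ 2 *\<^sub>R axis j 1) \<bullet> x" for w x
    by (simp add: \<pi>_def inner_real_2 inner_add_left inner_axis')
  have surj: "\<exists>x. \<pi> x = u" for u
    by (rule exI[of _ "\<chi> m. if m = i then u $ 1 else u $ 2"])
      (use ij in \<open>simp add: \<pi>_def vec_eq_iff forall_2\<close>)
  have line: "\<pi> -` L \<in> affine_subspaces (CARD('n) - 1)" if L: "L \<in> affine_subspaces 1" for L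
  proof -
    obtain w g where w: "w \<noteq> 0" "L = {u. w \<bullet> u = g}"
      using affine_subspaces_hyperplane[of L] L by auto
    let ?w = "w $ 1 *\<^sub>R axis i 1 + w $ 2 *\<^sub>R axis j 1 :: real ^ 'n"
    have "?w $ i = w $ 1" "?w $ j = w $ 2" using ij by (auto simp: axis_def)
    moreover have "w $ 1 \<noteq> 0 \<or> w $ 2 \<noteq> 0" using w(1) by (auto simp: vec_eq_iff forall_2)
    ultimately have "?w \<noteq> 0" by fastforce
    moreover have "\<pi> -` L = {x. ?w \<bullet> x = g}" using w(2) by (auto simp: inner_\<pi>)
    ultimately show ?thesis using affine_subspaces_hyperplane[of "\<pi> -` L"] by auto
  qed
  have point: "\<pi> -` {u} \<in> affine_subspaces (CARD('n) - 2)" for u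
  proof -
    let ?H = "{x :: real ^ 'n. axis i 1 \<bullet> x = u $ 1}" and ?K = "{x. axis j 1 \<bullet> x = u $ 2}"
    have eq: "\<pi> -` {u} = ?H \<inter> ?K"
      by (auto simp: \<pi>_def vec_eq_iff forall_2 inner_axis')
    have "?H \<inter> ?K \<noteq> {}" using surj[of u] eq by auto
    \<comment> \<open>Nonemptiness and this non-inclusion leave only the case in which intersecting
      with \<open>?K\<close> lowers the dimension by exactly one. The witness has the prescribed
      coordinate at \<open>i\<close> and misses the one at \<open>j\<close> by 1.\<close>
    moreover have "\<not> ?H \<subseteq> ?K"
    proof
      let ?x = "\<chi> m. if m = i then u $ 1 else u $ 2 + 1"
      assume "?H \<subseteq> ?K"
      moreover have "?x \<in> ?H" by (simp add: inner_axis')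
      ultimately have "?x \<in> ?K" by (rule subsetD)
      then show False using ij by (simp add: inner_axis')
    qed
    moreover have "aff_dim ?H = int CARD('n) - 1"
      using aff_dim_hyperplane[of "axis i 1 :: real ^ 'n" "u $ 1"] assms
      by (simp add: axis_eq_0_iff of_nat_diff del: aff_dim_hyperplane)
    ultimately have "aff_dim (?H \<inter> ?K) = int CARD('n) - 2"
      using aff_dim_affine_Int_hyperplane[OF affine_hyperplane,
        of "axis i 1 :: real ^ 'n" "u $ 1" "axis j 1" "u $ 2"]
      by simp
    then show ?thesis
      using assms unfolding affine_subspaces_def eq
      by (simp add: affine_Int affine_hyperplane of_nat_diff)
  qed
  \<comment> \<open>Fibres are nonempty by surjectivity, so the inclusion is never vacuous.\<close>
  have sub: "\<pi> -` {u} \<subseteq> \<pi> -` L \<longleftrightarrow> u \<in> L" for u L using surj[of u] by auto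
  have "\<exists>S'\<in>hyperplane_unions k. \<forall>y\<in>Y. \<pi> -` {y} \<in> S' \<longleftrightarrow> y \<in> S" if S: "S \<in> \<T>" for S
  proof -
    obtain l where l: "S = (\<Union>i\<in>{1..k}. l i)" "\<forall>i\<in>{1..k}. l i \<in> affine_subspaces 1"
      using subsetD[OF \<T> S] unfolding line_unions_def by blast
    show ?thesis
    proof (intro bexI ballI)
      show "{W \<in> affine_subspaces (CARD('n) - 2). \<exists>i\<in>{1..k}. W \<subseteq> \<pi> -` l i} \<in> hyperplane_unions k"
        unfolding hyperplane_unions_def
        by (intro CollectI exI[of _ "\<lambda>i. \<pi> -` l i"] conjI refl ballI line l(2)[rule_format])
      show "\<pi> -` {y} \<in> {W \<in> affine_subspaces (CARD('n) - 2). \<exists>i\<in>{1..k}. W \<subseteq> \<pi> -` l i} \<longleftrightarrow> y \<in> S"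
        for y
        by (simp only: l(1) mem_Collect_eq point sub UN_iff simp_thms)
    qed
  qed
  then show "\<exists>f. f ` Y \<subseteq> affine_subspaces (CARD('n) - 2) \<and>
      (\<forall>S\<in>\<T>. \<exists>S'\<in>hyperplane_unions k. \<forall>y\<in>Y. f y \<in> (S' :: (real ^ 'n) set set) \<longleftrightarrow> y \<in> S)"
    using point by (intro exI[of _ "\<lambda>u. \<pi> -` {u}"] conjI image_subsetI ballI) blast+
qed

theorem theorem8p1:
  fixes k :: nat
  assumes "CARD('n::finite) \<ge> 2" and "k \<ge> 1"
  shows "VC_dim (affine_subspaces (CARD('n) - 2) :: (real ^ 'n) set set) (hyperplane_unions k)
       = VC_dim (UNIV :: (real ^ 2) set) (line_unions k)"
  using VC_dim_hyperplane_unions_le[OF assms(1)] VC_dim_line_unions_le[OF assms(1)]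
  by (rule antisym)

end
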